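(* Let $\Xi$ be the $\mathbb{Q}$-linear span of all the shifted quasi-symmetric functions $\theta_\alpha$. Then $\Xi$ is a Hopf subalgebra of $\mathbb{Q}\otimes\mathcal{Q}\mathit{sym}$. Moreover the set $$\mathcal{J}=\{\Psi\in NC\mid \theta(\Psi)=0\text{ for all }\theta\in\Xi\}$$ is the principal ideal generated by $X_2=2h_2-h_1h_1$.
   Context: $NC=\mathbb{Z}\langle h_1,h_2,\ldots\rangle$ is the Hopf algebra of noncommutative symmetric functions: the free associative algebra over $\mathbb{Z}$ with one generator $h_k$ in each degree $k\ge1$ and coproduct $\Delta h_k=\sum_{i=0}^k h_i\otimes h_{k-i}$, where $h_0=1$. $\mathcal{Q}\mathit{sym}$ is the Hopf algebra of quasi-symmetric functions over $\mathbb{Z}$, the graded Hopf dual of $NC$: the monomial basis $M_\alpha=\sum_{i_1<\cdots<i_\ell} z_{i_1}^{\alpha_1}\cdots z_{i_\ell}^{\alpha_\ell}$ is dual to the basis $S^\alpha=h_{\alpha_1}\cdots h_{\alpha_\ell}$ ($\alpha$ a composition), that is, $M_\alpha(S^\beta)=1$ if $\alpha=\beta$ and $0$ otherwise. Thus elements of $\mathbb{Q}\otimes\mathcal{Q}\mathit{sym}$ are $\mathbb{Q}$-valued linear functionals on $NC$. For compositions $\alpha,\beta$ of $m$ (written $\beta\models m$), write $\beta\preccurlyeq\alpha$ if $\beta$ is a refinement of $\alpha$. Let $\beta^*$ be the refinement of $\beta$ obtained by replacing every component $\beta_i>1$ with $i>1$ by the two components $1,\beta_i-1$. Let $k(\beta)$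 be the number of components of $\beta$. For a composition $\alpha$ of $m$ with $\alpha_1>1$ if $m>1$, the (Billey–Haiman) shifted quasi-symmetric function is $$\theta_\alpha=\sum_{\beta\models m,\ \beta^*\preccurlyeq\alpha}2^{k(\beta)}M_\beta .$$
   Formalization: The principal ideal of X_2 is taken in Q⊗NC and intersected with NC: over Z the claim fails, since h_2h_1−h_1h_2 lies in J (twice it is X_2h_1−h_1X_2) but not in the integral ideal, whose degree 3 elements have an even coefficient of h_2h_1. *)

theory Defs
  imports
    Complex_Main
    "HOL-Library.Poly_Mapping"
    "HOL-Library.Product_Plus"
    "HOL-Library.Function_Algebras"
begin

section \<open>Compositions\<close>

typedef composition = "{xs :: nat list. 0 \<notin> set xs}"
  morphisms parts Abs_composition
  by (rule exI[of _ "[]"]) simp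

setup_lifting type_definition_composition

text \<open>Concatenation makes compositions the free monoid on the positive integers.\<close>

instantiation composition :: monoid_add
begin

lift_definition zero_composition :: composition is "[]" by simp

lift_definition plus_composition :: "composition \<Rightarrow> composition \<Rightarrow> composition" is "(@)" by simp

instance by standard (transfer; simp)+

end

definition weight :: "composition \<Rightarrow> nat" where
  "weight \<alpha> = sum_list (parts \<alpha>)"

text \<open>The composition with the single component \<open>k\<close>; the empty composition if \<open>k = 0\<close>.\<close>

lift_definition part :: "nat \<Rightarrow> composition" is "\<lambda>k. if k = 0 then [] else [k]" by simp

text \<open>\<open>refines b a\<close>: each component of \<open>a\<close> is the sum of a block of consecutive components
  of \<open>b\<close>. On lists of positive numbers the blocks are automatically nonempty.\<close>

definition refines :: "nat list \<Rightarrow> nat list \<Rightarrow> bool" where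
  "refines b a \<longleftrightarrow> (\<exists>blocks. b = concat blocks \<and> a = map sum_list blocks)"

fun star :: "nat list \<Rightarrow> nat list" where
  "star [] = []"
| "star (b # bs) = b # concat (map (\<lambda>c. if c > 1 then [1, c - 1] else [c]) bs)"

lemma finite_weight: "finite {\<beta>. weight \<beta> = m}"
proof -
  have len: "length xs \<le> sum_list xs" if "0 \<notin> set xs" for xs :: "nat list"
    using that by (induction xs) auto
  have "parts ` {\<beta>. weight \<beta> = m} \<subseteq> {xs. set xs \<subseteq> {..m} \<and> length xs \<le> m}"
    using len parts member_le_sum_list by (force simp: weight_def)
  then have "finite (parts ` {\<beta>. weight \<beta> = m})"
    by (rule finite_subset) (rule finite_lists_length_le, simp)
  then show ?thesis
    by (rule finite_imageD) (simp add: inj_on_def parts_inject)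
qed


section \<open>The Hopf algebra of noncommutative symmetric functions\<close>

text \<open>The free associative ring on \<open>h\<^sub>1, h\<^sub>2, \<dots>\<close> is the monoid ring of the free monoid of
  compositions: multiplication of finitely supported functions is convolution. Likewise, the
  tensor square is the monoid ring of the product monoid.\<close>

type_synonym NC = "composition \<Rightarrow>\<^sub>0 int"
type_synonym NC2 = "(composition \<times> composition) \<Rightarrow>\<^sub>0 int"

definition h :: "nat \<Rightarrow> NC" where
  "h k = Poly_Mapping.single (part k) 1"

definition S :: "composition \<Rightarrow> NC" where
  "S \<alpha> = prod_list (map h (parts \<alpha>))"

definition tensor :: "NC \<Rightarrow> NC \<Rightarrow> NC2" where
  "tensor \<Phi> \<Psi> = (\<Sum>\<alpha>\<in>Poly_Mapping.keys \<Phi>. \<Sum>\<beta>\<in>Poly_Mapping.keys \<Psi>.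
     Poly_Mapping.single (\<alpha>, \<beta>) (Poly_Mapping.lookup \<Phi> \<alpha> * Poly_Mapping.lookup \<Psi> \<beta>))"

definition nc_mult :: "NC2 \<Rightarrow> NC" where
  "nc_mult T = (\<Sum>(\<alpha>, \<beta>)\<in>Poly_Mapping.keys T. of_int (Poly_Mapping.lookup T (\<alpha>, \<beta>)) * (S \<alpha> * S \<beta>))"

text \<open>The algebra homomorphism with \<open>h\<^sub>k \<mapsto> \<Sum>\<^sub>i h\<^sub>i \<otimes> h\<^bsub>k-i\<^esub>\<close>.\<close>

definition nc_comult :: "NC \<Rightarrow> NC2" where
  "nc_comult \<Psi> = (\<Sum>\<alpha>\<in>Poly_Mapping.keys \<Psi>. of_int (Poly_Mapping.lookup \<Psi> \<alpha>) *
     prod_list (map (\<lambda>k. \<Sum>i\<le>k. tensor (h i) (h (k - i))) (parts \<alpha>)))"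

text \<open>The counit sends every \<open>h\<^sub>k\<close> with \<open>k \<ge> 1\<close> to \<open>0\<close>, so it reads off the constant term.\<close>

definition nc_counit :: "NC \<Rightarrow> int" where
  "nc_counit \<Psi> = Poly_Mapping.lookup \<Psi> 0"

text \<open>The antipode is the antihomomorphism whose values on the generators are determined by
  \<open>\<Sum>\<^sub>i antipode (h\<^sub>i) h\<^bsub>k-i\<^esub> = 0\<close> for \<open>k \<ge> 1\<close>.\<close>

fun antipode_h :: "nat \<Rightarrow> NC" where
  "antipode_h k = (if k = 0 then 1 else - (\<Sum>i<k. antipode_h i * h (k - i)))"

declare antipode_h.simps [simp del]

definition nc_antipode :: "NC \<Rightarrow> NC" where
  "nc_antipode \<Psi> = (\<Sum>\<alpha>\<in>Poly_Mapping.keys \<Psi>. of_int (Poly_Mapping.lookup \<Psi> \<alpha>) *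
     prod_list (rev (map antipode_h (parts \<alpha>))))"

lemma h_0 [simp]: "h 0 = 1"
proof -
  have "part 0 = 0" by transfer simp
  then show ?thesis by (simp add: h_def)
qed

lemma S_eq_single: "S \<alpha> = Poly_Mapping.single \<alpha> 1"
proof -
  have "prod_list (map h xs) = Poly_Mapping.single (Abs_composition xs) 1" if "0 \<notin> set xs" for xs
    using that
  proof (induction xs)
    case Nil
    have "Abs_composition [] = 0" by (simp add: zero_composition_def)
    then show ?case by simp
  next
    case (Cons x xs)
    then have "part x + Abs_composition xs = Abs_composition (x # xs)"
      by (simp add: part_def plus_composition_def Abs_composition_inverse)
    with Cons show ?case by (simp add: h_def mult_single)
  qed
  then show ?thesis using parts[of \<alpha>] by (simp add: S_def parts_inverse)
qed

lemma tensor_S: "tensor (S \<alpha>) (S \<beta>) = Poly_Mapping.single (\<alpha>, \<beta>) 1"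
  by (simp add: tensor_def S_eq_single)

lemma nc_comult_h: "nc_comult (h k) = (\<Sum>i\<le>k. tensor (h i) (h (k - i)))"
proof (cases "k = 0")
  case True
  have "parts 0 = []" by transfer simp
  moreover have "tensor 1 1 = 1" by (simp add: tensor_def flip: zero_prod_def)
  ultimately show ?thesis using True by (simp add: nc_comult_def)
next
  case False
  then have "parts (part k) = [k]" by transfer simp
  then show ?thesis by (simp add: nc_comult_def h_def)
qed

lemma nc_comult_S_mult: "nc_comult (S \<alpha> * S \<beta>) = nc_comult (S \<alpha>) * nc_comult (S \<beta>)"
  by (simp add: nc_comult_def S_eq_single mult_single plus_composition.rep_eq)

lemma sum_antipode_h: "k > 0 \<Longrightarrow> (\<Sum>i\<le>k. antipode_h i * h (k - i)) = 0"
  by (simp add: antipode_h.simps[of k] flip: lessThan_Suc_atMost)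


section \<open>Rational quasi-symmetric functions\<close>

text \<open>Rational quasi-symmetric functions are \<open>\<rat>\<close>-valued functionals on \<^typ>\<open>NC\<close>, and elements
  of the tensor square are functionals on \<^typ>\<open>NC2\<close>. The vector space operations are
  pointwise; the pointwise product of functions is \<^emph>\<open>not\<close> the product of quasi-symmetric
  functions, which is \<open>qsym_mult\<close> below.\<close>

definition qscale :: "rat \<Rightarrow> ('b \<Rightarrow> rat) \<Rightarrow> 'b \<Rightarrow> rat" where
  "qscale c F = (\<lambda>x. c * F x)"

global_interpretation qfun: vector_space qscale
  by standard (auto simp: qscale_def fun_eq_iff algebra_simps)

definition M :: "composition \<Rightarrow> NC \<Rightarrow> rat" where
  "M \<alpha> \<Psi> = of_int (Poly_Mapping.lookup \<Psi> \<alpha>)"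

lemma M_S: "M \<alpha> (S \<beta>) = (if \<alpha> = \<beta> then 1 else 0)"
  by (auto simp: M_def S_eq_single lookup_single)

definition QSym :: "(NC \<Rightarrow> rat) set" where
  "QSym = qfun.span (range M)"

definition functional_tensor :: "(NC \<Rightarrow> rat) \<Rightarrow> (NC \<Rightarrow> rat) \<Rightarrow> NC2 \<Rightarrow> rat" where
  "functional_tensor F G = (\<lambda>T. \<Sum>(\<alpha>, \<beta>)\<in>Poly_Mapping.keys T.
     of_int (Poly_Mapping.lookup T (\<alpha>, \<beta>)) * (F (S \<alpha>) * G (S \<beta>)))"

text \<open>The graded dual Hopf algebra structure: every operation is the transpose of one on
  \<^typ>\<open>NC\<close>.\<close>

definition qsym_one :: "NC \<Rightarrow> rat" where
  "qsym_one = (\<lambda>\<Psi>. of_int (nc_counit \<Psi>))"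

definition qsym_mult :: "(NC \<Rightarrow> rat) \<Rightarrow> (NC \<Rightarrow> rat) \<Rightarrow> NC \<Rightarrow> rat" where
  "qsym_mult F G = (\<lambda>\<Psi>. functional_tensor F G (nc_comult \<Psi>))"

definition qsym_comult :: "(NC \<Rightarrow> rat) \<Rightarrow> NC2 \<Rightarrow> rat" where
  "qsym_comult F = (\<lambda>T. F (nc_mult T))"

definition qsym_antipode :: "(NC \<Rightarrow> rat) \<Rightarrow> NC \<Rightarrow> rat" where
  "qsym_antipode F = (\<lambda>\<Psi>. F (nc_antipode \<Psi>))"

text \<open>No condition on the counit \<open>F \<mapsto> F 1\<close> is needed, since it restricts to any subspace.\<close>

definition hopf_subalgebra :: "(NC \<Rightarrow> rat) set \<Rightarrow> bool" where
  "hopf_subalgebra A \<longleftrightarrow>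
     A \<subseteq> QSym \<and>
     qfun.subspace A \<and>
     qsym_one \<in> A \<and>
     (\<forall>F\<in>A. \<forall>G\<in>A. qsym_mult F G \<in> A) \<and>
     (\<forall>F\<in>A. qsym_comult F \<in> qfun.span {functional_tensor G H | G H. G \<in> A \<and> H \<in> A}) \<and>
     (\<forall>F\<in>A. qsym_antipode F \<in> A)"


section \<open>Shifted quasi-symmetric functions\<close>

definition shifted_theta :: "composition \<Rightarrow> NC \<Rightarrow> rat" where
  "shifted_theta \<alpha> =
     (\<Sum>\<beta> | weight \<beta> = weight \<alpha> \<and> refines (star (parts \<beta>)) (parts \<alpha>).
        qscale (2 ^ length (parts \<beta>)) (M \<beta>))"

definition Xi :: "(NC \<Rightarrow> rat) set" where
  "Xi = qfun.span {shifted_theta \<alpha> | \<alpha>. weight \<alpha> > 1 \<longrightarrow> hd (parts \<alpha>) > 1}"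


section \<open>The annihilator and the ideal\<close>

definition J :: "NC set" where
  "J = {\<Psi>. \<forall>\<theta>\<in>Xi. \<theta> \<Psi> = 0}"

definition X2 :: NC where
  "X2 = 2 * h 2 - h 1 * h 1"

definition two_sided_ideal :: "'a::ring_1 set \<Rightarrow> bool" where
  "two_sided_ideal I \<longleftrightarrow>
     0 \<in> I \<and> (\<forall>x\<in>I. \<forall>y\<in>I. x + y \<in> I) \<and> (\<forall>x\<in>I. \<forall>r. r * x \<in> I \<and> x * r \<in> I)"

definition principal_ideal :: "'a::ring_1 \<Rightarrow> 'a set" where
  "principal_ideal x = \<Inter>{I. two_sided_ideal I \<and> x \<in> I}"

text \<open>The inclusion of \<^typ>\<open>NC\<close> into \<open>\<rat> \<otimes> NC\<close>. The ideal generated by \<^const>\<open>X2\<close> has to be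
  taken in \<open>\<rat> \<otimes> NC\<close>. In \<^typ>\<open>NC\<close> itself
  \<open>2 (h\<^sub>2 h\<^sub>1 - h\<^sub>1 h\<^sub>2) = X\<^sub>2 h\<^sub>1 - h\<^sub>1 X\<^sub>2\<close> is in the ideal generated by \<open>X\<^sub>2\<close>, so that
  \<open>h\<^sub>2 h\<^sub>1 - h\<^sub>1 h\<^sub>2\<close> is annihilated by every rational functional vanishing on that ideal, but
  \<open>h\<^sub>2 h\<^sub>1 - h\<^sub>1 h\<^sub>2\<close> is not in the ideal: its degree 3 part is spanned over \<open>\<int>\<close> by
  \<open>X\<^sub>2 h\<^sub>1\<close> and \<open>h\<^sub>1 X\<^sub>2\<close>, where the coefficient of \<open>h\<^sub>2 h\<^sub>1\<close> is even.\<close>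

definition rationalize :: "NC \<Rightarrow> (composition \<Rightarrow>\<^sub>0 rat)" where
  "rationalize \<Psi> = Poly_Mapping.map of_int \<Psi>"

end

theory Submission
  imports Defs
begin

text \<open>Let \<open>K\<close> be the space of quasi-symmetric functions vanishing on the two-sided ideal of
  \<open>X\<^sub>2\<close>, that is, \<open>2 F(S\<^bsup>u 2 v\<^esup>) = F(S\<^bsup>u 1 1 v\<^esup>)\<close> for all \<open>u\<close>, \<open>v\<close>. Every admissible
  \<open>\<theta>\<^sub>\<alpha>\<close> lies in \<open>K\<close>, because \<open>\<beta>\<^sup>*\<close> does not distinguish a component 2 from two components 1,
  except at the beginning, where \<open>\<alpha>\<^sub>1 > 1\<close> makes up for it. Conversely, an element of \<open>K\<close> is
  determined by its values on the words without 2. Sending such a word \<open>\<beta>\<close> to \<open>\<beta>\<^sup>*\<close>, with an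
  initial 1, 1 merged into 2, is injective into the admissible compositions and makes the matrix
  of coefficients of the \<open>\<theta>\<^sub>\<alpha>\<close> triangular for refinement; so \<open>\<Xi> = K\<close>. Since \<open>X\<^sub>2\<close> is primitive
  with antipode \<open>-X\<^sub>2\<close>, its ideal is a Hopf ideal, and \<open>K\<close> is a Hopf subalgebra. Finally, modulo
  \<open>X\<^sub>2\<close> each word is a multiple of a word without 2, and the corresponding coordinate functionals
  belong to \<open>K\<close>; hence the common kernel of \<open>K\<close> is the ideal.\<close>

section \<open>Linear extension of functions on basis elements\<close>

lemma additive_of_int: "additive (of_int :: int \<Rightarrow> 'b::ring_1)"
  by (simp add: additive_def)

lemma additive_of_int_mult:
  fixes F :: "'a::ring_1 \<Rightarrow> 'b::ring_1"
  assumes "additive F"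
  shows "F (of_int k * x) = of_int k * F x"
proof -
  have nat: "F (of_nat n * x) = of_nat n * F x" for n
    by (induction n) (simp_all add: additive.zero[OF assms] additive.add[OF assms] distrib_right)
  show ?thesis
    by (cases k) (simp_all add: nat additive.minus[OF assms] del: of_nat_Suc)
qed

lemma poly_mapping_induct [case_names single add]:
  fixes \<Phi> :: "'a \<Rightarrow>\<^sub>0 'k::ab_group_add"
  assumes single: "\<And>a k. P (Poly_Mapping.single a k)"
    and add: "\<And>\<Phi> \<Psi>. P \<Phi> \<Longrightarrow> P \<Psi> \<Longrightarrow> P (\<Phi> + \<Psi>)"
  shows "P \<Phi>"
proof (induction \<Phi> rule: update_induct)
  case const
  show ?case using single[of undefined 0] by simp
next
  case (update \<Phi> a k)
  then have "Poly_Mapping.update a k \<Phi> = \<Phi> + Poly_Mapping.single a k"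
    by (intro poly_mapping_eqI)
      (auto simp: lookup_update lookup_add lookup_single in_keys_iff when_def)
  with update.IH single add show ?case by simp
qed

text \<open>The coefficient embedding \<open>e\<close> is a parameter because integer coefficients
  (via \<open>of_int\<close>) and rational ones (via the identity) both occur. The target may be the
  rationals, \<open>NC\<close> or \<open>NC2\<close>, so functionals and structure maps are treated
  alike.\<close>

definition lin :: "('k::ab_group_add \<Rightarrow> 'b::ring_1) \<Rightarrow> ('a \<Rightarrow> 'b) \<Rightarrow> ('a \<Rightarrow>\<^sub>0 'k) \<Rightarrow> 'b" where
  "lin e c \<Phi> = (\<Sum>a\<in>Poly_Mapping.keys \<Phi>. e (Poly_Mapping.lookup \<Phi> a) * c a)"

lemma lin_superset:
  assumes "additive e" "finite A" "Poly_Mapping.keys \<Phi> \<subseteq> A"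
  shows "lin e c \<Phi> = (\<Sum>a\<in>A. e (Poly_Mapping.lookup \<Phi> a) * c a)"
  unfolding lin_def
  by (rule sum.mono_neutral_left) (use assms in \<open>auto simp: in_keys_iff additive.zero\<close>)

lemma additive_lin:
  fixes e :: "'b::ab_group_add \<Rightarrow> 'c::ring_1" and c :: "'a \<Rightarrow> 'c"
  shows "additive e \<Longrightarrow> additive (lin e c)"
proof
  fix \<Phi> \<Psi> :: "'a \<Rightarrow>\<^sub>0 'b" assume e: "additive e"
  let ?A = "Poly_Mapping.keys \<Phi> \<union> Poly_Mapping.keys \<Psi>"
  have "Poly_Mapping.keys (\<Phi> + \<Psi>) \<subseteq> ?A"
    by (rule keys_add)
  then show "lin e c (\<Phi> + \<Psi>) = lin e c \<Phi> + lin e c \<Psi>"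
    using e by (simp add: lin_superset[of e ?A] lookup_add additive.add distrib_right sum.distrib)
qed

lemma lin_single: "additive e \<Longrightarrow> lin e c (Poly_Mapping.single a k) = e k * c a"
  by (simp add: lin_def additive.zero)

text \<open>Composing a functional with a structure map given on words yields a functional given on
  words; this reduces the transposed operations to coefficient functions.\<close>

lemma lin_comp:
  assumes "additive F"
  shows "F (lin of_int c \<Phi>) = lin of_int (\<lambda>a. F (c a)) \<Phi>"
  by (simp add: lin_def additive.sum[OF assms] additive_of_int_mult[OF assms])

lemma nc_mult_eq_lin: "nc_mult = lin of_int (\<lambda>(\<alpha>, \<beta>). S (\<alpha> + \<beta>))"
  by (rule ext) (simp add: nc_mult_def lin_def S_eq_single mult_single split_def)

lemma M_eq_lin: "M \<alpha> = lin of_int (\<lambda>\<beta>. if \<beta> = \<alpha> then 1 else 0)"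
  by (rule ext) (simp add: M_def lin_def if_distrib in_keys_iff cong: if_cong)

lemma sum_fun_apply: "(\<Sum>i\<in>A. f i) x = (\<Sum>i\<in>A. f i x)"
  by (induction A rule: infinite_finite_induct) auto

lemma lin_eq_sum_M:
  assumes "finite A" "\<And>\<alpha>. \<alpha> \<notin> A \<Longrightarrow> f \<alpha> = 0"
  shows "lin of_int f = (\<Sum>\<alpha>\<in>A. qscale (f \<alpha>) (M \<alpha>))"
proof
  fix \<Psi> :: NC
  let ?B = "A \<union> Poly_Mapping.keys \<Psi>"
  have "lin of_int f \<Psi> = (\<Sum>\<alpha>\<in>?B. of_int (Poly_Mapping.lookup \<Psi> \<alpha>) * f \<alpha>)"
    using assms by (intro lin_superset) (auto simp: additive_of_int)
  also have "\<dots> = (\<Sum>\<alpha>\<in>A. f \<alpha> * of_int (Poly_Mapping.lookup \<Psi> \<alpha>))"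
    using assms by (intro sum.mono_neutral_cong_right) auto
  finally show "lin of_int f \<Psi> = (\<Sum>\<alpha>\<in>A. qscale (f \<alpha>) (M \<alpha>)) \<Psi>"
    by (simp add: qscale_def M_def sum_fun_apply)
qed

lemma lin_S: "lin of_int f (S \<alpha>) = f \<alpha>"
  by (simp add: S_eq_single lin_single additive_of_int)


section \<open>Compositions\<close>

lemma parts_zero [simp]: "parts 0 = []"
  by transfer simp

lemma parts_plus [simp]: "parts (\<alpha> + \<beta>) = parts \<alpha> @ parts \<beta>"
  by transfer simp

lemma parts_part: "k > 0 \<Longrightarrow> parts (part k) = [k]"
  by transfer simp

lemma parts_nonzero: "0 \<notin> set (parts \<alpha>)"
  using parts[of \<alpha>] by simp

lemma weight_zero [simp]: "weight 0 = 0"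
  by (simp add: weight_def)

lemma weight_plus [simp]: "weight (\<alpha> + \<beta>) = weight \<alpha> + weight \<beta>"
  by (simp add: weight_def)

lemma weight_part [simp]: "weight (part k) = k"
  unfolding weight_def by transfer simp

lemma length_le_sum_list: "0 \<notin> set xs \<Longrightarrow> length xs \<le> sum_list xs" for xs :: "nat list"
  by (induction xs) auto

lemma finite_weight_le: "finite {\<beta>. weight \<beta> \<le> m}"
proof -
  have "{\<beta>. weight \<beta> \<le> m} = (\<Union>n\<le>m. {\<beta>. weight \<beta> = n})" by auto
  then show ?thesis by (simp add: finite_weight)
qed

section \<open>Refinement of lists\<close>

lemma refines_Nil_right [simp]: "refines b [] \<longleftrightarrow> b = []"
  by (simp add: refines_def)

lemma refinesI: "b = concat bl \<Longrightarrow> a = map sum_list bl \<Longrightarrow> refines b a"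
  by (auto simp only: refines_def)

lemma refinesE:
  assumes "refines b a"
  obtains bl where "b = concat bl" "a = map sum_list bl"
  using assms by (auto simp only: refines_def)

lemma refines_Cons_right:
  "refines b (a # as) \<longleftrightarrow> (\<exists>b1 b2. b = b1 @ b2 \<and> sum_list b1 = a \<and> refines b2 as)"
proof
  assume "refines b (a # as)"
  then obtain bl where bl: "b = concat bl" "a # as = map sum_list bl"
    by (rule refinesE)
  then obtain b1 bl' where "bl = b1 # bl'"
    by (cases bl) simp_all
  with bl have "b = b1 @ concat bl'" "sum_list b1 = a" "refines (concat bl') as"
    by (simp_all add: refinesI)
  then show "\<exists>b1 b2. b = b1 @ b2 \<and> sum_list b1 = a \<and> refines b2 as"
    by iprover
next
  assume "\<exists>b1 b2. b = b1 @ b2 \<and> sum_list b1 = a \<and> refines b2 as"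
  then obtain b1 b2 where b: "b = b1 @ b2" "sum_list b1 = a" "refines b2 as"
    by iprover
  from b(3) obtain bl where "b2 = concat bl" "as = map sum_list bl"
    by (rule refinesE)
  with b show "refines b (a # as)"
    by (intro refinesI[of _ "b1 # bl"]) simp_all
qed

lemma refines_refl: "refines a a"
proof (induction a)
  case (Cons x a)
  then show ?case unfolding refines_Cons_right
    by (intro exI[of _ "[x]"] exI[of _ a]) simp
qed simp

text \<open>A block with positive sum is nonempty, so every component of \<open>a\<close> uses up at
  least one component of \<open>b\<close>; equal lengths force all blocks to be singletons.\<close>

lemma refines_length:
  "refines b a \<Longrightarrow> 0 \<notin> set a \<Longrightarrow> length a \<le> length b \<and> (length a = length b \<longrightarrow> a = b)"
proof (induction a arbitrary: b)
  case (Cons x a)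
  then obtain b1 b2 where b: "b = b1 @ b2" "sum_list b1 = x" "refines b2 a"
    by (auto simp: refines_Cons_right)
  with Cons.prems have "b1 \<noteq> []" by auto
  moreover have "length a \<le> length b2" "length a = length b2 \<longrightarrow> a = b2"
    using Cons.IH[OF b(3)] Cons.prems by auto
  ultimately show ?case using b by (cases b1) (auto simp: neq_Nil_conv)
qed simp

text \<open>As a > 1, the first block cannot end after the first 1; it contains both ones, and
  merging them into a 2 preserves its sum.\<close>

lemma refines_1_1:
  assumes "a > 1"
  shows "refines (1 # 1 # r) (a # as) \<longleftrightarrow> refines (2 # r) (a # as)"
proof
  assume "refines (1 # 1 # r) (a # as)"
  then obtain b1 b2 where b: "1 # 1 # r = b1 @ b2" "sum_list b1 = a" "refines b2 as"
    by (auto simp: refines_Cons_right)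
  with assms obtain c where "b1 = 1 # 1 # c" "r = c @ b2"
    by (auto simp: Cons_eq_append_conv)
  with b show "refines (2 # r) (a # as)"
    unfolding refines_Cons_right by (intro exI[of _ "2 # c"] exI[of _ b2]) auto
next
  assume "refines (2 # r) (a # as)"
  then obtain b1 b2 where b: "2 # r = b1 @ b2" "sum_list b1 = a" "refines b2 as"
    by (auto simp: refines_Cons_right)
  with assms obtain c where "b1 = 2 # c" "r = c @ b2"
    by (auto simp: Cons_eq_append_conv)
  with b show "refines (1 # 1 # r) (a # as)"
    unfolding refines_Cons_right by (intro exI[of _ "1 # 1 # c"] exI[of _ b2]) auto
qed

section \<open>The star operation and leading compositions\<close>

definition star_tail :: "nat list \<Rightarrow> nat list" where
  "star_tail xs = concat (map (\<lambda>c. if c > 1 then [1, c - 1] else [c]) xs)"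

lemma star_Cons [simp]: "star (x # xs) = x # star_tail xs"
  by (simp add: star_tail_def)

declare star.simps(2) [simp del]

lemma star_tail_Nil [simp]: "star_tail [] = []"
  by (simp add: star_tail_def)

lemma star_tail_append [simp]: "star_tail (xs @ ys) = star_tail xs @ star_tail ys"
  by (simp add: star_tail_def)

lemma star_tail_Cons: "star_tail (x # xs) = (if x > 1 then [1, x - 1] else [x]) @ star_tail xs"
  by (simp add: star_tail_def)

lemma sum_list_star_tail [simp]: "sum_list (star_tail xs) = sum_list xs"
  by (induction xs) (auto simp: star_tail_Cons)

lemma star_tail_nonzero: "0 \<notin> set xs \<Longrightarrow> 0 \<notin> set (star_tail xs)"
  by (induction xs) (auto simp: star_tail_Cons)

lemma star_tail_starts_1:
  "0 \<notin> set xs \<Longrightarrow> star_tail xs = [] \<or> (\<exists>r. star_tail xs = 1 # r)"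
  by (cases xs) (auto simp: star_tail_Cons)

text \<open>Excluding 2 makes decoding unambiguous: 2 and 1, 1 have the same image.\<close>

lemma star_tail_inject:
  "\<lbrakk>star_tail xs = star_tail ys; set xs \<inter> {0, 2} = {}; set ys \<inter> {0, 2} = {}\<rbrakk> \<Longrightarrow> xs = ys"
proof (induction xs arbitrary: ys)
  case Nil
  then show ?case by (cases ys) (auto simp: star_tail_Cons split: if_splits)
next
  case (Cons x xs)
  then obtain y ys' where ys: "ys = y # ys'"
    by (cases ys) (auto simp: star_tail_Cons split: if_splits)
  \<comment> \<open>Every encoded tail is empty or starts with 1, whereas x - 1 > 1 for x > 2; so
    the entry after the leading 1 tells a component 1 from a larger one.\<close>
  have "star_tail xs = [] \<or> (\<exists>r. star_tail xs = 1 # r)"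
    "star_tail ys' = [] \<or> (\<exists>r. star_tail ys' = 1 # r)"
    using Cons.prems ys by (simp_all add: star_tail_starts_1 del: One_nat_def)
  with Cons.prems ys have "x = y \<and> star_tail xs = star_tail ys'"
    by (auto simp: star_tail_Cons split: if_splits)
  with Cons ys show ?case by auto
qed

text \<open>The \<open>\<alpha>\<close> of an admissible \<open>\<theta>\<^sub>\<alpha>\<close> whose leading term is \<open>M\<^sub>\<beta>\<close>.\<close>

fun lead_list :: "nat list \<Rightarrow> nat list" where
  "lead_list [] = []"
| "lead_list [x] = [x]"
| "lead_list (x # y # xs) =
     (if x = 1 then 2 # tl (star_tail (y # xs)) else x # star_tail (y # xs))"

lemma lead_list_nonzero: "0 \<notin> set xs \<Longrightarrow> 0 \<notin> set (lead_list xs)"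
  by (induction xs rule: lead_list.induct) (auto simp: star_tail_nonzero star_tail_Cons)

lift_definition lead :: "composition \<Rightarrow> composition" is lead_list
  by (rule lead_list_nonzero)

lemma sum_list_lead_list: "0 \<notin> set xs \<Longrightarrow> sum_list (lead_list xs) = sum_list xs"
  by (induction xs rule: lead_list.induct) (auto simp: star_tail_Cons)

lemma weight_lead [simp]: "weight (lead \<beta>) = weight \<beta>"
  unfolding weight_def by transfer (simp add: sum_list_lead_list)

definition no_two :: "composition \<Rightarrow> bool" where
  "no_two \<beta> \<longleftrightarrow> 2 \<notin> set (parts \<beta>)"

lemma lead_list_hd: "\<lbrakk>set xs \<inter> {0, 2} = {}; sum_list xs > 1\<rbrakk> \<Longrightarrow> hd (lead_list xs) > 1"
  by (induction xs rule: lead_list.induct) auto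

lemma hd_lead: "\<lbrakk>no_two \<beta>; weight \<beta> > 1\<rbrakk> \<Longrightarrow> hd (parts (lead \<beta>)) > 1"
  unfolding no_two_def weight_def lead.rep_eq
  using parts_nonzero by (intro lead_list_hd) auto

text \<open>In the last two shapes the tail is encoded as \<open>1 # r\<close>. Naming
  \<open>r\<close> shows that \<open>lead_list\<close> and \<open>star\<close> agree except after a
  leading 1, where \<open>1 # 1 # r\<close> is merged into \<open>2 # r\<close>.\<close>

lemma lead_list_cases [consumes 1, case_names Nil single one large]:
  assumes "set xs \<inter> {0, 2} = {}"
  obtains "xs = []" "lead_list xs = []"
  | x where "xs = [x]" "lead_list xs = [x]" "x > 0" "x \<noteq> 2"
  | t r where "xs = 1 # t" "t \<noteq> []" "lead_list xs = 2 # r" "star_tail t = 1 # r"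
  | x t r where "xs = x # t" "t \<noteq> []" "x > 2" "lead_list xs = x # 1 # r" "star_tail t = 1 # r"
proof (cases xs rule: lead_list.cases)
  case (3 x y zs)
  then have xy: "x > 0" "x \<noteq> 2" "y > 0" "0 \<notin> set zs"
    using assms by auto
  define r where "r = tl (star_tail (y # zs))"
  have r: "star_tail (y # zs) = 1 # r"
    using xy by (auto simp: r_def star_tail_Cons)
  show thesis
  proof (cases "x = 1")
    case True
    with 3 r that(3)[of "y # zs" r] show thesis by simp
  next
    case False
    with 3 r xy that(4)[of x "y # zs" r] show thesis by simp
  qed
qed (use assms that(1,2) in auto)

text \<open>An image starting with 2 comes from a leading 1 with a nonempty tail, since 2 itself is
  excluded; every other nonempty image starts with the original first component. The tail is then
  recovered by \<open>star_tail_inject\<close>.\<close>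

lemma lead_list_inject:
  assumes eq: "lead_list xs = lead_list ys"
    and xs: "set xs \<inter> {0, 2} = {}" and ys: "set ys \<inter> {0, 2} = {}"
  shows "xs = ys"
  using xs
proof (cases xs rule: lead_list_cases)
  case Nil
  with eq have "lead_list ys = []" by simp
  with ys Nil(1) show ?thesis by (cases ys rule: lead_list_cases) simp_all
next
  case (single x)
  with eq have "lead_list ys = [x]" by simp
  with ys single(1,4) show ?thesis by (cases ys rule: lead_list_cases) simp_all
next
  case (one t r)
  with eq have lead: "lead_list ys = 2 # r" by simp
  from ys show ?thesis
  proof (cases ys rule: lead_list_cases)
    case one': (one t' r')
    with lead one(4) have "star_tail t = star_tail t'" by simp
    with xs ys one(1) one'(1) have "t = t'" by - (rule star_tail_inject, auto)
    with one(1) one'(1) show ?thesis by simp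
  qed (use lead in simp_all)
next
  case (large x t r)
  with eq have lead: "lead_list ys = x # 1 # r" by simp
  from ys show ?thesis
  proof (cases ys rule: lead_list_cases)
    case large': (large x' t' r')
    with lead large(5) have "star_tail t = star_tail t'" by simp
    with xs ys large(1) large'(1) have "t = t'" by - (rule star_tail_inject, auto)
    with large(1) large'(1,4) lead show ?thesis by simp
  qed (use lead large(3) in simp_all)
qed

text \<open>Only a leading 1 with a nonempty tail needs an argument: the weight then exceeds 1, so
  \<open>hd a > 1\<close>, and the initial 1, 1 may be merged by \<open>refines_1_1\<close>.\<close>

lemma refines_lead:
  assumes "refines (star xs) a" "set xs \<inter> {0, 2} = {}" "sum_list xs > 1 \<Longrightarrow> hd a > 1"
  shows "refines (lead_list xs) a"
  using assms(2)
proof (cases xs rule: lead_list_cases)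
  case (one t r)
  have "a \<noteq> []" using assms(1) one(1) by (intro notI) simp
  then obtain a1 as where a: "a = a1 # as" by (meson list.exhaust)
  have "sum_list t > 0" using arg_cong[OF one(4), of sum_list] by simp
  with one(1) assms(3) a have "a1 > 1" by simp
  with one(1,3,4) assms(1) a show ?thesis by (simp add: refines_1_1 del: One_nat_def)
qed (use assms(1) in auto)

text \<open>If M_\<gamma> occurs in the theta of \<open>lead \<beta>\<close>, then
  \<open>lead \<gamma>\<close> refines \<open>lead \<beta>\<close>; equal lengths make the two
  equal, and \<open>lead\<close> is injective on words without 2.\<close>

lemma lead_triangular:
  assumes "refines (star (parts \<gamma>)) (parts (lead \<beta>))" "no_two \<beta>" "no_two \<gamma>" "weight \<gamma> = weight \<beta>"
  shows "\<gamma> = \<beta> \<or> length (parts (lead \<gamma>)) > length (parts (lead \<beta>))"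
proof -
  have "refines (parts (lead \<gamma>)) (parts (lead \<beta>))"
    unfolding lead.rep_eq[of \<gamma>]
  proof (rule refines_lead[OF assms(1)])
    show "set (parts \<gamma>) \<inter> {0, 2} = {}"
      using assms(3) parts_nonzero[of \<gamma>] by (simp add: no_two_def)
    show "hd (parts (lead \<beta>)) > 1" if "sum_list (parts \<gamma>) > 1"
      using that assms hd_lead by (simp add: weight_def)
  qed
  then have "length (parts (lead \<beta>)) < length (parts (lead \<gamma>)) \<or> parts (lead \<beta>) = parts (lead \<gamma>)"
    using refines_length[OF _ parts_nonzero] by fastforce
  moreover have "\<gamma> = \<beta>" if "parts (lead \<beta>) = parts (lead \<gamma>)"
  proof -
    have "parts \<beta> = parts \<gamma>"
      using that assms(2,3) parts_nonzero
      by (intro lead_list_inject[OF that[unfolded lead.rep_eq]]) (auto simp: no_two_def)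
    then show ?thesis by (simp add: parts_inject)
  qed
  ultimately show ?thesis by blast
qed

text \<open>Provides the nonzero diagonal of the triangular matrix: a merged initial 2 is the sum of
  the block 1, 1.\<close>

lemma refines_star_lead: "no_two \<beta> \<Longrightarrow> refines (star (parts \<beta>)) (parts (lead \<beta>))"
proof -
  have "refines (star xs) (lead_list xs)" if "set xs \<inter> {0, 2} = {}" for xs
    using that
  proof (cases xs rule: lead_list_cases)
    case (one t r)
    then show ?thesis by (simp add: refines_1_1 refines_refl del: One_nat_def)
  qed (use refines_refl in auto)
  then show "no_two \<beta> \<Longrightarrow> ?thesis"
    using parts_nonzero[of \<beta>] by (simp add: no_two_def lead.rep_eq)
qed

section \<open>Normal forms of words modulo \<open>X2\<close>\<close>

lift_definition expand :: "composition \<Rightarrow> composition" is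
  "\<lambda>xs. concat (map (\<lambda>c. if c = 2 then [1, 1] else [c]) xs)"
  by auto

text \<open>The exponent of 1/2 picked up in passing to the normal form, because h_2 is congruent to
  half of h_1 h_1.\<close>

definition twos :: "composition \<Rightarrow> nat" where
  "twos \<alpha> = count_list (parts \<alpha>) 2"

lemma expand_plus: "expand (\<alpha> + \<beta>) = expand \<alpha> + expand \<beta>"
  by transfer simp

lemma twos_plus: "twos (\<alpha> + \<beta>) = twos \<alpha> + twos \<beta>"
  by (simp add: twos_def)

lemma expand_part_2: "expand (part 2) = part 1 + part 1"
  by transfer simp

lemma expand_part_1: "expand (part 1) = part 1"
  by transfer simp

lemma twos_part: "twos (part 2) = 1" "twos (part 1) = 0"
  by (simp_all add: twos_def parts_part)

lemma weight_expand: "weight (expand \<alpha>) = weight \<alpha>"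
proof -
  have "sum_list (concat (map (\<lambda>c. if c = 2 then [1, 1] else [c]) xs)) = sum_list xs" for xs :: "nat list"
    by (induction xs) auto
  then show ?thesis unfolding weight_def by transfer simp
qed

lemma no_two_expand: "no_two (expand \<alpha>)"
  unfolding no_two_def by transfer auto

lemma composition_induct [case_names zero plus]:
  assumes "P 0" "\<And>k \<alpha>. k > 0 \<Longrightarrow> P \<alpha> \<Longrightarrow> P (part k + \<alpha>)"
  shows "P \<alpha>"
proof (induction "parts \<alpha>" arbitrary: \<alpha>)
  case Nil
  then have "\<alpha> = 0" by (metis parts_inject parts_zero)
  with assms(1) show ?case by simp
next
  case (Cons k xs)
  have "0 \<notin> set (k # xs)"
    unfolding Cons.hyps(2) by (rule parts_nonzero)
  then have "k > 0" "0 \<notin> set xs"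
    by simp_all
  then have xs: "parts (Abs_composition xs) = xs"
    by (simp add: Abs_composition_inverse)
  then have "P (Abs_composition xs)"
    by (rule Cons.hyps(1)[OF sym])
  with \<open>k > 0\<close> have "P (part k + Abs_composition xs)"
    by (rule assms(2))
  moreover have "part k + Abs_composition xs = \<alpha>"
    using Cons.hyps(2) \<open>k > 0\<close> xs by (intro parts_inject[THEN iffD1]) (simp add: parts_part)
  ultimately show ?case by simp
qed

section \<open>Functionals vanishing on the ideal of \<open>X\<^sub>2\<close>\<close>

declare One_nat_def [simp del]

lemma part_0 [simp]: "part 0 = 0"
  by transfer simp

lemma lin_zero_fun: "lin e (\<lambda>_. 0) = 0"
  by (rule ext) (simp add: lin_def)

lemma lin_fun_add: "lin e (\<lambda>a. f a + g a) \<Phi> = lin e f \<Phi> + lin e g \<Phi>"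
  by (simp add: lin_def distrib_left sum.distrib)

lemma lin_fun_scale: "lin e (\<lambda>a. c * f a) \<Phi> = c * lin e f \<Phi>" for c :: "'b::comm_ring_1"
  by (simp add: lin_def sum_distrib_left mult.left_commute)

lemma lin_fun_sum: "lin e (\<lambda>a. \<Sum>i\<in>I. g i a) \<Phi> = (\<Sum>i\<in>I. lin e (g i) \<Phi>)"
  unfolding lin_def sum_distrib_left by (rule sum.swap)

text \<open>Vanishing of \<open>lin of_int f\<close> on all \<open>S u * X2 * S v\<close>, with sums
  nested to the right to match rewriting by \<open>add.assoc\<close>.\<close>

definition kills_X2 :: "(composition \<Rightarrow> rat) \<Rightarrow> bool" where
  "kills_X2 f \<longleftrightarrow> (\<forall>u v. f (u + (part 1 + (part 1 + v))) = 2 * f (u + (part 2 + v)))"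

text \<open>There are finitely many compositions of each weight, so this means finite support and
  keeps functionals such as infinite sums of the M_\<alpha> out of \<open>K\<close>.\<close>

definition bounded_weight :: "(composition \<Rightarrow> rat) \<Rightarrow> bool" where
  "bounded_weight f \<longleftrightarrow> (\<exists>N. \<forall>\<alpha>. weight \<alpha> > N \<longrightarrow> f \<alpha> = 0)"

definition K :: "(NC \<Rightarrow> rat) set" where
  "K = {lin of_int f | f. kills_X2 f \<and> bounded_weight f}"

lemma KI: "kills_X2 f \<Longrightarrow> bounded_weight f \<Longrightarrow> lin of_int f \<in> K"
  by (auto simp: K_def)

lemma KE:
  assumes "F \<in> K"
  obtains f where "F = lin of_int f" "kills_X2 f" "bounded_weight f"
  using assms by (auto simp: K_def)

lemma kills_X2_D: "kills_X2 f \<Longrightarrow> f (u + (part 1 + (part 1 + v))) = 2 * f (u + (part 2 + v))"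
  by (simp add: kills_X2_def)

lemma expand_part: "k \<noteq> 2 \<Longrightarrow> expand (part k) = part k"
  by transfer simp

lemma twos_part_eq_0: "k \<noteq> 2 \<Longrightarrow> twos (part k) = 0"
  unfolding twos_def by transfer simp

lemma expand_zero [simp]: "expand 0 = 0"
  by transfer simp

lemma twos_zero [simp]: "twos 0 = 0"
  by (simp add: twos_def)

text \<open>Each component 2 is replaced at the cost of a factor 1/2. The prefix \<open>u\<close> is
  arbitrary because the induction rewrites from the right, with the components still untreated
  standing in front.\<close>

lemma kills_X2_expand:
  assumes "kills_X2 f"
  shows "f (u + \<alpha>) = f (u + expand \<alpha>) / 2 ^ twos \<alpha>"
proof (induction \<alpha> arbitrary: u rule: composition_induct)
  case (plus k \<alpha>)
  have "f (u + (part k + \<alpha>)) = f (u + (part k + expand \<alpha>)) / 2 ^ twos \<alpha>"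
    using plus.IH[of "u + part k"] by (simp add: add.assoc)
  then show ?case
    using kills_X2_D[OF assms, of u "expand \<alpha>"]
    by (cases "k = 2")
      (simp_all add: expand_plus twos_plus expand_part_2 twos_part expand_part twos_part_eq_0 add.assoc power_add)
qed simp

section \<open>The shifted functions and the subspace \<open>K\<close>\<close>

definition theta_coeff :: "composition \<Rightarrow> composition \<Rightarrow> rat" where
  "theta_coeff \<alpha> \<beta> =
     (if weight \<beta> = weight \<alpha> \<and> refines (star (parts \<beta>)) (parts \<alpha>) then 2 ^ length (parts \<beta>) else 0)"

lemma shifted_theta_eq_sum:
  "shifted_theta \<alpha> = (\<Sum>\<beta> | weight \<beta> = weight \<alpha> \<and> refines (star (parts \<beta>)) (parts \<alpha>).
     qscale (theta_coeff \<alpha> \<beta>) (M \<beta>))"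
  unfolding shifted_theta_def by (rule sum.cong) (simp_all add: theta_coeff_def)

lemma shifted_theta_eq_lin: "shifted_theta \<alpha> = lin of_int (theta_coeff \<alpha>)"
  unfolding shifted_theta_eq_sum
  by (rule lin_eq_sum_M[symmetric])
    (auto simp: theta_coeff_def intro: finite_subset[OF _ finite_weight[of "weight \<alpha>"]])

text \<open>Behind the first position, \<open>star\<close> turns 2 into 1, 1, so both words satisfy
  the same refinement condition; the coefficient doubles because the word with 1, 1 has one
  component more.\<close>

lemma kills_X2_theta:
  assumes "weight \<alpha> > 1 \<longrightarrow> hd (parts \<alpha>) > 1"
  shows "kills_X2 (theta_coeff \<alpha>)"
  unfolding kills_X2_def
proof (intro allI)
  fix u v
  have "refines (star (parts (u + (part 2 + v)))) (parts \<alpha>) \<longleftrightarrow>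
      refines (star (parts (u + (part 1 + (part 1 + v))))) (parts \<alpha>)"
    if w: "weight (u + (part 2 + v)) = weight \<alpha>"
  proof (cases "parts u")
    case (Cons k xs)
    then show ?thesis by (simp add: parts_part star_tail_Cons One_nat_def)
  next
    \<comment> \<open>At the front \<open>star\<close> keeps 2 and 1, 1 apart, but refining a list
      whose first component exceeds 1 does not distinguish them.\<close>
    case Nil
    have "hd (parts \<alpha>) > 1" using w assms by auto
    moreover have "parts \<alpha> \<noteq> []" using w by (auto simp: weight_def parts_part)
    ultimately obtain a as where a: "parts \<alpha> = a # as" "a > 1" by (cases "parts \<alpha>") simp_all
    then show ?thesis by (simp add: Nil parts_part star_tail_Cons refines_1_1)
  qed
  then show "theta_coeff \<alpha> (u + (part 1 + (part 1 + v))) = 2 * theta_coeff \<alpha> (u + (part 2 + v))"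
    by (auto simp: theta_coeff_def parts_part)
qed

lemma bounded_weight_theta: "bounded_weight (theta_coeff \<alpha>)"
  unfolding bounded_weight_def by (intro exI[of _ "weight \<alpha>"]) (simp add: theta_coeff_def)

lemma kills_X2_lincomb:
  assumes "kills_X2 f" "kills_X2 g"
  shows "kills_X2 (\<lambda>\<alpha>. f \<alpha> + c * g \<alpha>)"
  unfolding kills_X2_def by (simp add: kills_X2_D[OF assms(1)] kills_X2_D[OF assms(2)] algebra_simps)

lemma kills_X2_sum: "(\<And>i. i \<in> I \<Longrightarrow> kills_X2 (g i)) \<Longrightarrow> kills_X2 (\<lambda>\<alpha>. \<Sum>i\<in>I. c i * g i \<alpha>)"
  unfolding kills_X2_def by (simp add: sum_distrib_left algebra_simps)

lemma bounded_weight_lincomb: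
  assumes "bounded_weight f" "bounded_weight g"
  shows "bounded_weight (\<lambda>\<alpha>. f \<alpha> + c * g \<alpha>)"
proof -
  obtain m n where "\<forall>\<alpha>. weight \<alpha> > m \<longrightarrow> f \<alpha> = 0" "\<forall>\<alpha>. weight \<alpha> > n \<longrightarrow> g \<alpha> = 0"
    using assms by (auto simp: bounded_weight_def)
  then show ?thesis
    unfolding bounded_weight_def by (intro exI[of _ "max m n"]) simp
qed

lemma subspace_K: "qfun.subspace K"
proof -
  have zero: "kills_X2 (\<lambda>_. 0)" "bounded_weight (\<lambda>_. 0)"
    by (simp_all add: kills_X2_def bounded_weight_def)
  have lincomb: "F + qscale c G \<in> K" if FG: "F \<in> K" "G \<in> K" for F G c
  proof -
    obtain f where f: "F = lin of_int f" "kills_X2 f" "bounded_weight f" using FG(1) by (rule KE)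
    obtain g where g: "G = lin of_int g" "kills_X2 g" "bounded_weight g" using FG(2) by (rule KE)
    have "F + qscale c G = lin of_int (\<lambda>\<alpha>. f \<alpha> + c * g \<alpha>)"
      by (rule ext) (simp add: f g lin_fun_add lin_fun_scale qscale_def)
    then show ?thesis
      using f g by (simp add: KI kills_X2_lincomb bounded_weight_lincomb)
  qed
  have K0: "0 \<in> K"
    using KI[OF zero] by (simp only: lin_zero_fun)
  have "F + G \<in> K" if "F \<in> K" "G \<in> K" for F G
    using lincomb[OF that, of 1] by (simp add: qscale_def)
  moreover have "qscale c G \<in> K" if "G \<in> K" for G c
    using lincomb[OF K0 that, of c] by simp
  ultimately show ?thesis
    using K0 by (simp add: qfun.subspace_def)
qed

lemma Xi_subset_K: "Xi \<subseteq> K"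
  unfolding Xi_def
  by (rule qfun.span_minimal[OF _ subspace_K])
    (auto simp: shifted_theta_eq_lin intro!: KI kills_X2_theta bounded_weight_theta)

section \<open>Triangularity and the equality of \<open>Xi\<close> and \<open>K\<close>\<close>

lemma shifted_theta_lead_in_Xi: "no_two \<beta> \<Longrightarrow> shifted_theta (lead \<beta>) \<in> Xi"
  unfolding Xi_def by (rule qfun.span_base) (use hd_lead[of \<beta>] in auto)

lemma theta_coeff_lead_self: "no_two \<beta> \<Longrightarrow> theta_coeff (lead \<beta>) \<beta> = 2 ^ length (parts \<beta>)"
  by (simp add: theta_coeff_def refines_star_lead)

lemma theta_coeff_lead_eq_0:
  assumes "no_two \<beta>" "no_two \<gamma>" "\<gamma> \<noteq> \<beta>" "length (parts (lead \<gamma>)) \<le> length (parts (lead \<beta>))"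
  shows "theta_coeff (lead \<beta>) \<gamma> = 0"
  using lead_triangular[OF _ assms(1,2)] assms(3,4) by (auto simp: theta_coeff_def)

text \<open>Triangular elimination along the number of components of \<open>lead \<beta>\<close>.\<close>

lemma lin_in_Xi:
  assumes "kills_X2 f" "\<forall>\<alpha>. weight \<alpha> > N \<longrightarrow> f \<alpha> = 0"
    and "\<forall>\<beta>. no_two \<beta> \<and> length (parts (lead \<beta>)) < n \<longrightarrow> f \<beta> = 0"
  shows "lin of_int f \<in> Xi"
  using assms
proof (induction "Suc N - n" arbitrary: f n)
  case 0
  \<comment> \<open>Here n > N, while \<open>lead \<beta>\<close> has at most as many components as
    its weight; so \<open>f\<close> vanishes on all words without 2, hence everywhere.\<close>
  have "f \<beta> = 0" if "no_two \<beta>" for \<beta>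
  proof (cases "weight \<beta> > N")
    case False
    then have "length (parts (lead \<beta>)) < n"
      using 0(1) length_le_sum_list[OF parts_nonzero, of "lead \<beta>"] weight_lead[of \<beta>]
      by (simp add: weight_def)
    with that 0(4) show ?thesis by simp
  qed (use 0(3) in simp)
  then have "f \<alpha> = 0" for \<alpha>
    using kills_X2_expand[OF 0(2), of 0 \<alpha>] no_two_expand by simp
  then have "f = (\<lambda>_. 0)" by blast
  then show ?case by (simp only: lin_zero_fun Xi_def qfun.span_zero)
next
  case (Suc m)
  define B where "B = {\<beta>. weight \<beta> \<le> N \<and> no_two \<beta> \<and> length (parts (lead \<beta>)) = n}"
  \<comment> \<open>Division by the diagonal entry makes the combination \<open>g\<close> of thetas
    agree with \<open>f\<close> on level n.\<close>
  define c where "c = (\<lambda>\<beta>. f \<beta> / 2 ^ length (parts \<beta>))"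
  define g where "g = (\<lambda>\<alpha>. \<Sum>\<beta>\<in>B. c \<beta> * theta_coeff (lead \<beta>) \<alpha>)"
  define f' where "f' = (\<lambda>\<alpha>. f \<alpha> + (- 1) * g \<alpha>)"
  have fin: "finite B"
    unfolding B_def by (rule finite_subset[OF _ finite_weight_le[of N]]) auto
  have g_kills: "kills_X2 g"
    unfolding g_def by (intro kills_X2_sum kills_X2_theta) (auto simp: B_def dest: hd_lead)
  have "theta_coeff (lead \<beta>) \<alpha> = 0" if "\<beta> \<in> B" "weight \<alpha> > N" for \<alpha> \<beta>
    using that by (simp add: theta_coeff_def B_def)
  then have g_bd: "g \<alpha> = 0" if "weight \<alpha> > N" for \<alpha>
    using that by (simp add: g_def)
  \<comment> \<open>On levels below n both sides are 0, so subtracting \<open>g\<close> preserves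
    the vanishing already achieved.\<close>
  have g_val: "g \<gamma> = f \<gamma>" if \<gamma>: "no_two \<gamma>" "length (parts (lead \<gamma>)) \<le> n" for \<gamma>
  proof (cases "weight \<gamma> > N")
    case True
    then show ?thesis using g_bd Suc.prems(2) by simp
  next
    case False
    have "c \<beta> * theta_coeff (lead \<beta>) \<gamma> = (if \<beta> = \<gamma> then f \<gamma> else 0)" if "\<beta> \<in> B" for \<beta>
      using that \<gamma> theta_coeff_lead_eq_0[of \<beta> \<gamma>] theta_coeff_lead_self[of \<gamma>]
      by (auto simp: B_def c_def)
    then have "g \<gamma> = (\<Sum>\<beta>\<in>B. if \<beta> = \<gamma> then f \<gamma> else 0)"
      by (simp add: g_def)
    also have "\<dots> = (if \<gamma> \<in> B then f \<gamma> else 0)"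
      using fin by simp
    also have "\<dots> = f \<gamma>"
      using Suc.prems(3) \<gamma> False by (auto simp: B_def)
    finally show ?thesis .
  qed
  have "lin of_int f' \<in> Xi"
  proof (rule Suc.hyps(1))
    show "m = Suc N - Suc n" using Suc.hyps(2) by simp
    show "kills_X2 f'" unfolding f'_def by (rule kills_X2_lincomb[OF Suc.prems(1) g_kills])
    show "\<forall>\<alpha>. N < weight \<alpha> \<longrightarrow> f' \<alpha> = 0" using Suc.prems(2) g_bd by (simp add: f'_def)
    show "\<forall>\<beta>. no_two \<beta> \<and> length (parts (lead \<beta>)) < Suc n \<longrightarrow> f' \<beta> = 0"
      using g_val by (simp add: f'_def)
  qed
  moreover have "(\<Sum>\<beta>\<in>B. qscale (c \<beta>) (shifted_theta (lead \<beta>))) \<in> Xi"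
    unfolding Xi_def
    by (intro qfun.span_sum qfun.span_scale shifted_theta_lead_in_Xi[unfolded Xi_def])
      (simp add: B_def)
  moreover have "lin of_int f = lin of_int f' + (\<Sum>\<beta>\<in>B. qscale (c \<beta>) (shifted_theta (lead \<beta>)))"
  proof
    fix \<Psi> :: NC
    have "lin of_int f \<Psi> = lin of_int (\<lambda>\<alpha>. f' \<alpha> + g \<alpha>) \<Psi>"
      by (simp add: f'_def)
    then show "lin of_int f \<Psi> =
        (lin of_int f' + (\<Sum>\<beta>\<in>B. qscale (c \<beta>) (shifted_theta (lead \<beta>)))) \<Psi>"
      by (simp add: lin_fun_add g_def lin_fun_sum lin_fun_scale sum_fun_apply qscale_def
          shifted_theta_eq_lin)
  qed
  ultimately show ?case
    unfolding Xi_def by (simp only: qfun.span_add)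
qed

lemma Xi_eq_K: "Xi = K"
proof
  show "K \<subseteq> Xi"
  proof
    fix F assume "F \<in> K"
    then obtain f N where "F = lin of_int f" "kills_X2 f" "\<forall>\<alpha>. weight \<alpha> > N \<longrightarrow> f \<alpha> = 0"
      by (auto simp: K_def bounded_weight_def)
    \<comment> \<open>For n = 0 the vanishing condition is empty.\<close>
    then show "F \<in> Xi" using lin_in_Xi[of f N 0] by simp
  qed
qed (rule Xi_subset_K)

section \<open>Closure under the Hopf algebra operations\<close>

lemma additive_twice: "additive F \<Longrightarrow> 2 * F x = F (x + x)" for F :: "'a::ab_group_add \<Rightarrow> 'b::ring_1"
  by (simp add: additive.add mult_2)

section \<open>Homogeneous elements\<close>

text \<open>The grading is a parameter so that words and pairs of words share these lemmas;
  homogeneous images of words yield \<open>bounded_weight\<close> for the transposed maps.\<close>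

definition homogeneous :: "('a \<Rightarrow> nat) \<Rightarrow> nat \<Rightarrow> ('a \<Rightarrow>\<^sub>0 'k::zero) \<Rightarrow> bool" where
  "homogeneous wt n \<Phi> \<longleftrightarrow> (\<forall>a\<in>Poly_Mapping.keys \<Phi>. wt a = n)"

lemma homogeneous_zero: "homogeneous wt n 0"
  by (simp add: homogeneous_def)

lemma homogeneous_single: "wt a = n \<Longrightarrow> homogeneous wt n (Poly_Mapping.single a k)"
  by (simp add: homogeneous_def)

lemma homogeneous_add:
  "homogeneous wt n \<Phi> \<Longrightarrow> homogeneous wt n \<Psi> \<Longrightarrow> homogeneous wt n (\<Phi> + \<Psi>)"
  using keys_add[of \<Phi> \<Psi>] by (auto simp: homogeneous_def)

lemma homogeneous_sum:
  "(\<And>i. i \<in> I \<Longrightarrow> homogeneous wt n (f i)) \<Longrightarrow> homogeneous wt n (\<Sum>i\<in>I. f i)"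
  by (induction I rule: infinite_finite_induct) (simp_all add: homogeneous_zero homogeneous_add)

lemma homogeneous_mult:
  assumes "\<And>a b. wt (a + b) = wt a + wt b" "homogeneous wt m \<Phi>" "homogeneous wt n \<Psi>"
  shows "homogeneous wt (m + n) (\<Phi> * \<Psi>)"
  using keys_mult[of \<Phi> \<Psi>] assms unfolding homogeneous_def by fastforce

lemma homogeneous_prod_list:
  fixes \<phi> :: "nat \<Rightarrow> 'a::monoid_add \<Rightarrow>\<^sub>0 'k::semiring_1"
  assumes "\<And>a b. wt (a + b) = wt a + wt b" "\<And>k. homogeneous wt k (\<phi> k)"
  shows "homogeneous wt (sum_list ks) (prod_list (map \<phi> ks))"
proof (induction ks)
  case Nil
  have "wt 0 = 0" using assms(1)[of 0 0] by simp
  then show ?case by (simp add: homogeneous_single flip: single_one)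
qed (simp add: homogeneous_mult assms)

subsection \<open>Product\<close>

definition comult_word :: "composition \<Rightarrow> NC2" where
  "comult_word \<alpha> = prod_list (map (\<lambda>k. \<Sum>i\<le>k. tensor (h i) (h (k - i))) (parts \<alpha>))"

lemma nc_comult_eq_lin: "nc_comult = lin of_int comult_word"
  by (rule ext) (simp add: nc_comult_def lin_def comult_word_def)

lemma comult_word_plus: "comult_word (\<alpha> + \<beta>) = comult_word \<alpha> * comult_word \<beta>"
  by (simp add: comult_word_def)

lemma tensor_h: "tensor (h i) (h j) = Poly_Mapping.single (part i, part j) 1"
  by (simp add: tensor_def h_def)

lemma comult_word_part: "k > 0 \<Longrightarrow> comult_word (part k) = (\<Sum>i\<le>k. Poly_Mapping.single (part i, part (k - i)) 1)"
  by (simp add: comult_word_def parts_part tensor_h)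

text \<open>\<open>X2\<close> is primitive: the coproducts of 2 h_2 and of h_1 h_1 both contain the
  mixed term h_1 \<otimes> h_1 twice, so it cancels.\<close>

lemma comult_word_X2:
  "comult_word (part 2) + comult_word (part 2) - comult_word (part 1) * comult_word (part 1) =
     Poly_Mapping.single (part 2, 0) 2 - Poly_Mapping.single (part 1 + part 1, 0) 1 +
     (Poly_Mapping.single (0, part 2) 2 - Poly_Mapping.single (0, part 1 + part 1) 1)"
proof -
  have "comult_word (part 1) = Poly_Mapping.single (0, part 1) 1 + Poly_Mapping.single (part 1, 0) 1"
    by (subst comult_word_part) (simp_all add: One_nat_def)
  moreover have "comult_word (part 2) = Poly_Mapping.single (0, part 2) 1 +
      Poly_Mapping.single (part 1, part 1) 1 + Poly_Mapping.single (part 2, 0) 1"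
    by (subst comult_word_part) (simp_all add: numeral_2_eq_2 One_nat_def)
  moreover have "Poly_Mapping.single a (2::int) = Poly_Mapping.single a 1 + Poly_Mapping.single a 1"
    for a :: "composition \<times> composition"
    by (simp flip: single_add)
  ultimately show ?thesis
    by (simp add: algebra_simps mult_single)
qed

definition prod_weight :: "composition \<times> composition \<Rightarrow> nat" where
  "prod_weight = (\<lambda>(\<alpha>, \<beta>). weight \<alpha> + weight \<beta>)"

lemma prod_weight_plus: "prod_weight (a + b) = prod_weight a + prod_weight b"
  by (cases a; cases b) (simp add: prod_weight_def)

lemma homogeneous_comult_word: "homogeneous prod_weight (weight \<alpha>) (comult_word \<alpha>)"
  unfolding comult_word_def weight_def
  by (intro homogeneous_prod_list prod_weight_plus homogeneous_sum)
    (simp add: tensor_h homogeneous_single prod_weight_def)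

text \<open>By additivity \<open>A\<close> and \<open>B\<close> may be taken to be monomials; then
  \<open>f\<close> kills the part with \<open>X2\<close> in the left factor and \<open>g\<close> the
  part with \<open>X2\<close> in the right one.\<close>

lemma lin_tensor_X2_eq_0:
  assumes "kills_X2 f" "kills_X2 g"
  shows "lin of_int (\<lambda>(\<alpha>, \<beta>). f \<alpha> * g \<beta>) (A * (Poly_Mapping.single (part 2, 0) 2 -
     Poly_Mapping.single (part 1 + part 1, 0) 1 + (Poly_Mapping.single (0, part 2) 2 -
     Poly_Mapping.single (0, part 1 + part 1) 1)) * B) = 0" (is "?T (A * ?Y * B) = 0")
proof -
  have add: "?T (x + y) = ?T x + ?T y" and diff: "?T (x - y) = ?T x - ?T y" for x y
    by (simp_all add: additive_lin additive_of_int additive.add additive.diff)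
  have "?T (Poly_Mapping.single a c * ?Y * Poly_Mapping.single b d) = 0" for a b c d
    by (cases a; cases b)
      (simp add: distrib_left distrib_right left_diff_distrib right_diff_distrib mult_single add diff
        lin_single additive_of_int add.assoc kills_X2_D[OF assms(1)] kills_X2_D[OF assms(2)])
  then have "?T (Poly_Mapping.single a c * ?Y * B) = 0" for a c
    by (induction B rule: poly_mapping_induct) (simp_all add: distrib_left add)
  then show ?thesis
    by (induction A rule: poly_mapping_induct) (simp_all only: distrib_right add add_0)
qed

lemma functional_tensor_lin:
  "functional_tensor (lin of_int f) (lin of_int g) = lin of_int (\<lambda>(\<alpha>, \<beta>). f \<alpha> * g \<beta>)"
  by (rule ext, simp add: functional_tensor_def split_def lin_S, simp add: lin_def)

lemma qsym_mult_in_K: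
  assumes "F \<in> K" "G \<in> K"
  shows "qsym_mult F G \<in> K"
proof -
  obtain f where f: "F = lin of_int f" "kills_X2 f" "bounded_weight f" using assms(1) by (rule KE)
  obtain g where g: "G = lin of_int g" "kills_X2 g" "bounded_weight g" using assms(2) by (rule KE)
  define T where "T = lin of_int (\<lambda>(\<alpha>, \<beta>). f \<alpha> * g \<beta>)"
  have T: "additive T"
    unfolding T_def by (intro additive_lin additive_of_int)
  have "qsym_mult F G = lin of_int (\<lambda>\<alpha>. T (comult_word \<alpha>))"
    by (rule ext) (simp add: qsym_mult_def f(1) g(1) functional_tensor_lin nc_comult_eq_lin
        lin_comp[OF T] flip: T_def)
  moreover have "kills_X2 (\<lambda>\<alpha>. T (comult_word \<alpha>))"
    unfolding kills_X2_def
  proof (intro allI)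
    fix u v
    \<comment> \<open>Multiplicativity of the coproduct turns the condition for u and v into a
      two-sided multiple of the coproduct of \<open>X2\<close>.\<close>
    have "T (comult_word u * (comult_word (part 2) + comult_word (part 2) -
        comult_word (part 1) * comult_word (part 1)) * comult_word v) = 0"
      unfolding comult_word_X2 T_def by (rule lin_tensor_X2_eq_0[OF f(2) g(2)])
    also have "comult_word u * (comult_word (part 2) + comult_word (part 2) -
        comult_word (part 1) * comult_word (part 1)) * comult_word v =
        comult_word (u + (part 2 + v)) + comult_word (u + (part 2 + v)) -
        comult_word (u + (part 1 + (part 1 + v)))"
      by (simp add: comult_word_plus algebra_simps)
    finally show "T (comult_word (u + (part 1 + (part 1 + v)))) = 2 * T (comult_word (u + (part 2 + v)))"
      unfolding additive.diff[OF T] additive.add[OF T] by linarith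
  qed
  moreover have "bounded_weight (\<lambda>\<alpha>. T (comult_word \<alpha>))"
  proof -
    obtain m n where mn: "\<forall>\<alpha>. weight \<alpha> > m \<longrightarrow> f \<alpha> = 0" "\<forall>\<alpha>. weight \<alpha> > n \<longrightarrow> g \<alpha> = 0"
      using f(3) g(3) by (auto simp: bounded_weight_def)
    have "T (comult_word \<alpha>) = 0" if "weight \<alpha> > m + n" for \<alpha>
      unfolding T_def lin_def
    proof (rule sum.neutral, safe)
      fix a b assume "(a, b) \<in> Poly_Mapping.keys (comult_word \<alpha>)"
      \<comment> \<open>Total weight above m + n pushes one tensor factor beyond the support of
        \<open>f\<close> or of \<open>g\<close>.\<close>
      then have "weight a + weight b > m + n"
        using homogeneous_comult_word[of \<alpha>] that by (auto simp: homogeneous_def prod_weight_def)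
      then have "weight a > m \<or> weight b > n"
        by linarith
      with mn show "of_int (Poly_Mapping.lookup (comult_word \<alpha>) (a, b)) * (f a * g b) = 0"
        by auto
    qed
    then show ?thesis unfolding bounded_weight_def by blast
  qed
  ultimately show ?thesis by (simp add: KI)
qed

lemma qsym_one_in_K: "qsym_one \<in> K"
proof -
  have "qsym_one = M 0"
    by (rule ext) (simp add: qsym_one_def nc_counit_def M_def)
  then have one: "qsym_one = lin of_int (\<lambda>\<beta>. if \<beta> = 0 then 1 else 0)"
    by (simp only: M_eq_lin)
  \<comment> \<open>A word with a positive component is nonempty, so both sides of the relation are
    0.\<close>
  have "u + (part k + v) \<noteq> 0" if "k > 0" for k u v
    using that by (auto dest: arg_cong[of _ _ weight])
  then have "kills_X2 (\<lambda>\<beta>. if \<beta> = 0 then 1 else 0)"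
    by (simp add: kills_X2_def)
  moreover have "bounded_weight (\<lambda>\<beta>. if \<beta> = 0 then 1 else 0)"
    by (auto simp: bounded_weight_def)
  ultimately show ?thesis unfolding one by (rule KI)
qed

subsection \<open>Antipode\<close>

definition antipode_word :: "composition \<Rightarrow> NC" where
  "antipode_word \<alpha> = prod_list (rev (map antipode_h (parts \<alpha>)))"

lemma nc_antipode_eq_lin: "nc_antipode = lin of_int antipode_word"
  by (rule ext) (simp add: nc_antipode_def lin_def antipode_word_def)

lemma antipode_word_plus: "antipode_word (\<alpha> + \<beta>) = antipode_word \<beta> * antipode_word \<alpha>"
  by (simp add: antipode_word_def)

text \<open>The recursion gives \<open>antipode_h 2 = h 1 * h 1 - h 2\<close>, so the antipode
  negates \<open>X2\<close>.\<close>

lemma antipode_word_X2: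
  "antipode_word (part 2) + antipode_word (part 2) - antipode_word (part 1) * antipode_word (part 1) =
     - (Poly_Mapping.single (part 2) 2 - Poly_Mapping.single (part 1 + part 1) 1)"
proof -
  have 0: "antipode_h 0 = 1" by (simp add: antipode_h.simps)
  have 1: "antipode_h 1 = - h 1" by (subst antipode_h.simps) (simp add: 0 One_nat_def)
  have "antipode_h 2 = h 1 * h 1 - h 2"
    by (subst antipode_h.simps) (simp add: 0 1[unfolded One_nat_def] numeral_2_eq_2 One_nat_def)
  moreover have "Poly_Mapping.single (part 2) (2::int) = h 2 + h 2"
    by (simp add: h_def flip: single_add)
  moreover have "Poly_Mapping.single (part 1 + part 1) (1::int) = h 1 * h 1"
    by (simp add: h_def mult_single)
  ultimately show ?thesis
    by (simp add: antipode_word_def parts_part 1)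
qed

lemma homogeneous_antipode_h: "homogeneous weight k (antipode_h k)"
proof (induction k rule: less_induct)
  case (less k)
  have "homogeneous weight (i + (k - i)) (antipode_h i * h (k - i))" if "i < k" for i
    using less[OF that] by (intro homogeneous_mult) (simp_all add: h_def homogeneous_single)
  then have "homogeneous weight k (\<Sum>i<k. antipode_h i * h (k - i))"
    by (intro homogeneous_sum) fastforce
  then show ?case
    by (subst antipode_h.simps) (auto simp: homogeneous_def)
qed

lemma homogeneous_antipode_word: "homogeneous weight (weight \<alpha>) (antipode_word \<alpha>)"
  using homogeneous_prod_list[OF weight_plus homogeneous_antipode_h, of "rev (parts \<alpha>)"]
  by (simp add: antipode_word_def weight_def rev_map)

text \<open>Additivity reduces to monomials \<open>A\<close> and \<open>B\<close>, where the claim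
  is the relation in \<open>kills_X2\<close>. Integer coefficients serve the antipode, rational ones
  the annihilator.\<close>

lemma lin_X2_eq_0:
  fixes e :: "'k::ring_1 \<Rightarrow> rat"
  assumes "kills_X2 f" "additive e"
  shows "lin e f (A * (Poly_Mapping.single (part 2) 2 - Poly_Mapping.single (part 1 + part 1) 1) * B) = 0"
    (is "lin e f (A * ?Y * B) = 0")
proof -
  have add: "lin e f (x + y) = lin e f x + lin e f y" and diff: "lin e f (x - y) = lin e f x - lin e f y" for x y
    by (simp_all add: assms additive_lin additive.add additive.diff)
  \<comment> \<open>The map \<open>e\<close> is only assumed additive, so doubling is written as a
    sum before it is taken out.\<close>
  have "c * 2 * d = c * d + c * d" for c d :: 'k
    by (simp add: mult_2_right distrib_right)
  then have "e (c * 2 * d) = 2 * e (c * d)" for c d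
    by (simp only: additive_twice[OF assms(2)])
  then have "lin e f (Poly_Mapping.single a c * ?Y * Poly_Mapping.single b d) = 0" for a b c d
    by (simp add: left_diff_distrib right_diff_distrib mult_single diff
        lin_single assms(2) add.assoc kills_X2_D[OF assms(1)])
  then have "lin e f (Poly_Mapping.single a c * ?Y * B) = 0" for a c
    by (induction B rule: poly_mapping_induct) (simp_all add: distrib_left add)
  then show ?thesis
    by (induction A rule: poly_mapping_induct) (simp_all only: distrib_right add add_0)
qed

lemma qsym_antipode_in_K:
  assumes "F \<in> K"
  shows "qsym_antipode F \<in> K"
proof -
  obtain f where f: "F = lin of_int f" "kills_X2 f" "bounded_weight f" using assms by (rule KE)
  have F: "additive F"
    unfolding f(1) by (intro additive_lin additive_of_int)
  have "qsym_antipode F = lin of_int (\<lambda>\<alpha>. F (antipode_word \<alpha>))"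
    by (rule ext) (simp add: qsym_antipode_def nc_antipode_eq_lin lin_comp[OF F])
  moreover have "kills_X2 (\<lambda>\<alpha>. F (antipode_word \<alpha>))"
    unfolding kills_X2_def
  proof (intro allI)
    fix u v
    \<comment> \<open>The antipode reverses products, hence v on the left and u on the
      right.\<close>
    have "F (antipode_word v * (antipode_word (part 2) + antipode_word (part 2) -
        antipode_word (part 1) * antipode_word (part 1)) * antipode_word u) = 0"
      unfolding antipode_word_X2
      \<comment> \<open>The minus sign of the image of \<open>X2\<close> is absorbed into the left
        factor.\<close>
      using lin_X2_eq_0[OF f(2) additive_of_int, of "- antipode_word v" "antipode_word u"]
      by (simp only: f(1) mult_minus_left mult_minus_right)
    also have "antipode_word v * (antipode_word (part 2) + antipode_word (part 2) -
        antipode_word (part 1) * antipode_word (part 1)) * antipode_word u =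
        antipode_word (u + (part 2 + v)) + antipode_word (u + (part 2 + v)) -
        antipode_word (u + (part 1 + (part 1 + v)))"
      by (simp add: antipode_word_plus algebra_simps)
    finally show "F (antipode_word (u + (part 1 + (part 1 + v)))) = 2 * F (antipode_word (u + (part 2 + v)))"
      unfolding additive.diff[OF F] additive.add[OF F] by linarith
  qed
  moreover have "bounded_weight (\<lambda>\<alpha>. F (antipode_word \<alpha>))"
  proof -
    obtain m where m: "\<forall>\<alpha>. weight \<alpha> > m \<longrightarrow> f \<alpha> = 0"
      using f(3) by (auto simp: bounded_weight_def)
    have "F (antipode_word \<alpha>) = 0" if "weight \<alpha> > m" for \<alpha>
      unfolding f(1) lin_def
      by (rule sum.neutral) (use m that homogeneous_antipode_word[of \<alpha>] in \<open>auto simp: homogeneous_def\<close>)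
    then show ?thesis unfolding bounded_weight_def by blast
  qed
  ultimately show ?thesis by (simp add: KI)
qed

subsection \<open>Coproduct\<close>

text \<open>The basis of the quotient by \<open>X\<^sub>2\<close> consists of the words without 2, each word \<open>\<alpha>\<close>
  being congruent to \<open>2\<^bsup>-twos \<alpha>\<^esup>\<close> times \<open>expand \<alpha>\<close>; these are the coordinate functionals.\<close>

definition coord :: "composition \<Rightarrow> composition \<Rightarrow> rat" where
  "coord w \<alpha> = (if expand \<alpha> = w then 1 / 2 ^ twos \<alpha> else 0)"

lemma kills_X2_coord: "kills_X2 (coord w)"
  by (simp add: kills_X2_def coord_def expand_plus expand_part_2 expand_part_1 twos_plus twos_part
      power_add add.assoc)

lemma bounded_weight_coord: "bounded_weight (coord w)"
  unfolding bounded_weight_def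
  by (intro exI[of _ "weight w"]) (auto simp: coord_def weight_expand)

lemma lin_coord_in_K: "lin of_int (coord w) \<in> K"
  by (intro KI kills_X2_coord bounded_weight_coord)

text \<open>Only w = \<open>expand \<alpha>\<close> and w' = \<open>expand \<beta>\<close>
  contribute, and \<open>expand\<close> respects concatenation. The variables are thereby separated,
  which makes the coproduct a finite sum of tensors of coordinate functionals.\<close>

lemma kills_X2_plus_eq:
  assumes "kills_X2 f" "\<forall>\<alpha>. weight \<alpha> > N \<longrightarrow> f \<alpha> = 0"
  shows "f (\<alpha> + \<beta>) = (\<Sum>w | weight w \<le> N. \<Sum>w' | weight w' \<le> N. f (w + w') * (coord w \<alpha> * coord w' \<beta>))"
proof -
  have "(\<Sum>w | weight w \<le> N. \<Sum>w' | weight w' \<le> N. f (w + w') * (coord w \<alpha> * coord w' \<beta>)) =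
      (\<Sum>w | weight w \<le> N. if w = expand \<alpha> then \<Sum>w' | weight w' \<le> N.
        if w' = expand \<beta> then f (expand \<alpha> + expand \<beta>) / 2 ^ twos \<alpha> / 2 ^ twos \<beta> else 0 else 0)"
    by (intro sum.cong refl) (auto simp: coord_def intro!: sum.cong)
  also have "\<dots> = (if weight \<alpha> \<le> N \<and> weight \<beta> \<le> N
      then f (expand \<alpha> + expand \<beta>) / 2 ^ twos \<alpha> / 2 ^ twos \<beta> else 0)"
    by (simp add: finite_weight_le weight_expand)
  \<comment> \<open>If either weight exceeds N, so does that of the concatenation, where
    \<open>f\<close> is 0.\<close>
  also have "\<dots> = f (expand \<alpha> + expand \<beta>) / 2 ^ twos \<alpha> / 2 ^ twos \<beta>"
    using assms(2) by (auto simp: weight_expand)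
  also have "\<dots> = f (\<alpha> + \<beta>)"
    using kills_X2_expand[OF assms(1), of 0 "\<alpha> + \<beta>"] by (simp add: expand_plus twos_plus power_add)
  finally show ?thesis by simp
qed

lemma qsym_comult_in_span:
  assumes "F \<in> K"
  shows "qsym_comult F \<in> qfun.span {functional_tensor G H | G H. G \<in> K \<and> H \<in> K}"
proof -
  obtain f N where f: "F = lin of_int f" "kills_X2 f" "\<forall>\<alpha>. weight \<alpha> > N \<longrightarrow> f \<alpha> = 0"
    using assms by (auto simp: K_def bounded_weight_def)
  have F: "additive F"
    unfolding f(1) by (intro additive_lin additive_of_int)
  have "qsym_comult F T = (\<Sum>w | weight w \<le> N. \<Sum>w' | weight w' \<le> N. f (w + w') *
      functional_tensor (lin of_int (coord w)) (lin of_int (coord w')) T)" for T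
  proof -
    have "qsym_comult F T = lin of_int (\<lambda>a. F (S (fst a + snd a))) T"
      by (simp add: qsym_comult_def nc_mult_eq_lin lin_comp[OF F] split_def)
    also have "\<dots> = lin of_int (\<lambda>a. \<Sum>w | weight w \<le> N. \<Sum>w' | weight w' \<le> N.
        f (w + w') * (coord w (fst a) * coord w' (snd a))) T"
      unfolding f(1) lin_S
      by (rule arg_cong[of _ _ "\<lambda>c. lin of_int c T"], rule ext, rule kills_X2_plus_eq[OF f(2,3)])
    also have "\<dots> = (\<Sum>w | weight w \<le> N. \<Sum>w' | weight w' \<le> N. f (w + w') *
        lin of_int (\<lambda>a. coord w (fst a) * coord w' (snd a)) T)"
      by (simp add: lin_fun_sum lin_fun_scale)
    finally show ?thesis
      by (simp add: functional_tensor_lin split_def)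
  qed
  then have "qsym_comult F = (\<Sum>w | weight w \<le> N. \<Sum>w' | weight w' \<le> N. qscale (f (w + w'))
      (functional_tensor (lin of_int (coord w)) (lin of_int (coord w'))))"
    by (simp add: fun_eq_iff sum_fun_apply qscale_def)
  also have "\<dots> \<in> qfun.span {functional_tensor G H | G H. G \<in> K \<and> H \<in> K}"
    by (intro qfun.span_sum qfun.span_scale qfun.span_base) (blast intro: lin_coord_in_K)
  finally show ?thesis .
qed

lemma Xi_subset_QSym: "Xi \<subseteq> QSym"
proof -
  have "shifted_theta \<alpha> \<in> QSym" for \<alpha>
    unfolding shifted_theta_def QSym_def
    by (intro qfun.span_sum qfun.span_scale qfun.span_base) simp
  then show ?thesis
    unfolding Xi_def QSym_def by (intro qfun.span_minimal) auto
qed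

lemma hopf_subalgebra_Xi: "hopf_subalgebra Xi"
  unfolding hopf_subalgebra_def
  using Xi_subset_QSym subspace_K qsym_one_in_K qsym_mult_in_K qsym_comult_in_span qsym_antipode_in_K
  by (simp add: Xi_eq_K)


section \<open>The annihilator\<close>

lemma lookup_rationalize [simp]: "Poly_Mapping.lookup (rationalize \<Psi>) \<alpha> = of_int (Poly_Mapping.lookup \<Psi> \<alpha>)"
  by (simp add: rationalize_def Poly_Mapping.map.rep_eq when_def)

lemma keys_rationalize [simp]: "Poly_Mapping.keys (rationalize \<Psi>) = Poly_Mapping.keys \<Psi>"
  by (auto simp: in_keys_iff)

lemma lin_rationalize: "lin (\<lambda>x. x) f (rationalize \<Psi>) = lin of_int f \<Psi>"
  by (simp add: lin_def)

lemma X2_eq: "X2 = Poly_Mapping.single (part 2) 2 - Poly_Mapping.single (part 1 + part 1) 1"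
  by (simp add: X2_def h_def mult_2 mult_single flip: single_add)

lemma rationalize_X2:
  "rationalize X2 = Poly_Mapping.single (part 2) 2 - Poly_Mapping.single (part 1 + part 1) 1"
  by (rule poly_mapping_eqI) (simp add: X2_eq lookup_minus lookup_single when_def)

lemma two_sided_ideal_sum:
  "two_sided_ideal I \<Longrightarrow> (\<And>i. i \<in> A \<Longrightarrow> x i \<in> I) \<Longrightarrow> (\<Sum>i\<in>A. x i) \<in> I"
  by (induction A rule: infinite_finite_induct) (auto simp: two_sided_ideal_def)

lemma two_sided_ideal_add: "two_sided_ideal I \<Longrightarrow> x \<in> I \<Longrightarrow> y \<in> I \<Longrightarrow> x + y \<in> I"
  by (simp add: two_sided_ideal_def)

lemma two_sided_ideal_mult:
  "two_sided_ideal I \<Longrightarrow> x \<in> I \<Longrightarrow> a * x * b \<in> I"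
  by (simp add: two_sided_ideal_def)

text \<open>Each 2 is removed, from right to left, by a two-sided multiple of \<open>X2\<close>; the
  halving takes place in the rational coefficients.\<close>

lemma single_cong_expand:
  fixes c :: rat
  assumes I: "two_sided_ideal I" "rationalize X2 \<in> I"
  shows "Poly_Mapping.single (u + \<beta>) c - Poly_Mapping.single (u + expand \<beta>) (c / 2 ^ twos \<beta>) \<in> I"
proof (induction \<beta> arbitrary: u rule: composition_induct)
  case zero
  show ?case using I by (simp add: two_sided_ideal_def)
next
  case (plus k \<alpha>)
  let ?c = "c / 2 ^ twos \<alpha>"
  have IH: "Poly_Mapping.single (u + (part k + \<alpha>)) c - Poly_Mapping.single (u + (part k + expand \<alpha>)) ?c \<in> I"
    using plus.IH[of "u + part k"] by (simp add: add.assoc)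
  show ?case
  proof (cases "k = 2")
    case False
    with IH show ?thesis by (simp add: expand_plus twos_plus expand_part twos_part_eq_0)
  next
    case True
    \<comment> \<open>The factor \<open>?c / 2\<close> compensates the coefficient 2 of h_2 in
      \<open>X2\<close>.\<close>
    have "Poly_Mapping.single u (?c / 2) * rationalize X2 * Poly_Mapping.single (expand \<alpha>) 1 \<in> I"
      using I by (rule two_sided_ideal_mult)
    also have "Poly_Mapping.single u (?c / 2) * rationalize X2 * Poly_Mapping.single (expand \<alpha>) 1 =
        Poly_Mapping.single (u + (part 2 + expand \<alpha>)) ?c -
        Poly_Mapping.single (u + (part 1 + (part 1 + expand \<alpha>))) (?c / 2)"
      by (simp add: rationalize_X2 left_diff_distrib right_diff_distrib mult_single add.assoc)
    finally have "(Poly_Mapping.single (u + (part 2 + \<alpha>)) c - Poly_Mapping.single (u + (part 2 + expand \<alpha>)) ?c) +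
        (Poly_Mapping.single (u + (part 2 + expand \<alpha>)) ?c -
        Poly_Mapping.single (u + (part 1 + (part 1 + expand \<alpha>))) (?c / 2)) \<in> I"
      using IH I(1) unfolding True by (intro two_sided_ideal_add)
    then show ?thesis
      by (simp add: True expand_plus expand_part_2 twos_plus twos_part power_add add.assoc mult.commute)
  qed
qed

lemma poly_mapping_eq_sum_single:
  "\<Phi> = (\<Sum>a\<in>Poly_Mapping.keys \<Phi>. Poly_Mapping.single a (Poly_Mapping.lookup \<Phi> a))"
  by (rule poly_mapping_eqI) (simp add: lookup_sum lookup_single when_def in_keys_iff)

text \<open>If all of \<open>K\<close> kills \<Psi>, the normal form of \<Psi> is 0, so \<Psi> is a
  sum of differences lying in every ideal that contains \<open>X2\<close>. Conversely, the kernel of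
  each functional in \<open>K\<close>, extended rationally, includes an ideal containing
  \<open>X2\<close>.\<close>

lemma J_iff: "\<Psi> \<in> J \<longleftrightarrow> rationalize \<Psi> \<in> principal_ideal (rationalize X2)"
proof
  assume \<Psi>: "\<Psi> \<in> J"
  have "rationalize \<Psi> \<in> I" if I: "two_sided_ideal I" "rationalize X2 \<in> I" for I
  proof -
    let ?c = "\<lambda>\<beta>. rat_of_int (Poly_Mapping.lookup \<Psi> \<beta>)"
    have "(\<Sum>\<beta>\<in>Poly_Mapping.keys \<Psi>. Poly_Mapping.single (expand \<beta>) (?c \<beta> / 2 ^ twos \<beta>)) = 0"
    proof (rule poly_mapping_eqI)
      fix w
      \<comment> \<open>The coefficient of the normal form at w is the value of the functional
        \<open>coord w\<close> at \<Psi>.\<close>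
      have "lin of_int (coord w) \<Psi> = 0"
        using \<Psi> lin_coord_in_K[of w] by (simp add: J_def Xi_eq_K)
      then show "Poly_Mapping.lookup (\<Sum>\<beta>\<in>Poly_Mapping.keys \<Psi>.
          Poly_Mapping.single (expand \<beta>) (?c \<beta> / 2 ^ twos \<beta>)) w = Poly_Mapping.lookup 0 w"
        by (simp add: lookup_sum lookup_single when_def lin_def coord_def if_distrib cong: if_cong)
    qed
    moreover have "(\<Sum>\<beta>\<in>Poly_Mapping.keys \<Psi>. Poly_Mapping.single \<beta> (?c \<beta>) -
        Poly_Mapping.single (expand \<beta>) (?c \<beta> / 2 ^ twos \<beta>)) \<in> I"
      using single_cong_expand[OF I, of 0] by (intro two_sided_ideal_sum[OF I(1)]) simp
    ultimately show ?thesis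
      using poly_mapping_eq_sum_single[of "rationalize \<Psi>"] by (simp add: sum_subtractf)
  qed
  then show "rationalize \<Psi> \<in> principal_ideal (rationalize X2)"
    by (auto simp: principal_ideal_def)
next
  assume \<Psi>: "rationalize \<Psi> \<in> principal_ideal (rationalize X2)"
  have "F \<Psi> = 0" if F: "F \<in> K" for F
  proof -
    obtain f where f: "F = lin of_int f" "kills_X2 f" "bounded_weight f"
      using F by (rule KE)
    \<comment> \<open>This is the largest two-sided ideal inside the kernel of the rational
      extension of \<open>F\<close>.\<close>
    define I where "I = {\<Phi>. \<forall>A B. lin (\<lambda>x. x) f (A * \<Phi> * B) = 0}"
    have id: "additive (\<lambda>x::rat. x)" by (simp add: additive_def)
    have "two_sided_ideal I"
      unfolding two_sided_ideal_def
    proof (intro conjI ballI allI)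
      show "0 \<in> I" by (simp add: I_def lin_def)
      show "x + y \<in> I" if "x \<in> I" "y \<in> I" for x y
        using that by (simp add: I_def distrib_left distrib_right additive.add[OF additive_lin[OF id]])
      show "r * x \<in> I" if "x \<in> I" for x r
        using that by (simp add: I_def flip: mult.assoc)
      show "x * r \<in> I" if "x \<in> I" for x r
        using that by (simp add: I_def mult.assoc)
    qed
    moreover have "rationalize X2 \<in> I"
      unfolding I_def rationalize_X2 using lin_X2_eq_0[OF f(2) id] by blast
    ultimately have "rationalize \<Psi> \<in> I"
      using \<Psi> by (auto simp: principal_ideal_def)
    then have "lin (\<lambda>x. x) f (1 * rationalize \<Psi> * 1) = 0"
      unfolding I_def by blast
    then show ?thesis by (simp add: f(1) lin_rationalize)
  qed
  then show "\<Psi> \<in> J" by (simp add: J_def Xi_eq_K)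
qed

theorem theorem5p7:
  shows "hopf_subalgebra Xi \<and>
         J = {\<Psi>. rationalize \<Psi> \<in> principal_ideal (rationalize X2)}"
  using hopf_subalgebra_Xi J_iff by blast

end
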